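(* Let $(\boldsymbol{x},\boldsymbol{n},\boldsymbol{s}):U\to\mathbb{R}^3\times\Delta$ be a framed surface with basic invariants $a_i,b_i,e_i,f_i,g_i$ ($i=1,2$). Then $(\boldsymbol{x},\boldsymbol{n},\boldsymbol{s})$ is an $(\boldsymbol{s},\overline{\boldsymbol{s}})$-Bertrand framed surface if and only if there exist smooth functions $\lambda,\theta:U\to\mathbb{R}$ with $\lambda\not\equiv0$ such that $$\begin{pmatrix} b_1(u,v)+\lambda(u,v)g_1(u,v) & \lambda(u,v)e_1(u,v)\\ b_2(u,v)+\lambda(u,v)g_2(u,v) & \lambda(u,v)e_2(u,v)\end{pmatrix}\begin{pmatrix}\sin\theta(u,v)\\ -\cos\theta(u,v)\end{pmatrix}=\begin{pmatrix}0\\0\end{pmatrix}$$ for all $(u,v)\in U$.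
   Context: All maps are $C^\infty$. $U\subset\mathbb{R}^2$ is a simply connected domain with coordinates $(u,v)$, $S^2$ is the unit sphere in $\mathbb{R}^3$, and $\Delta=\{(\boldsymbol{a},\boldsymbol{b})\in S^2\times S^2 : \boldsymbol{a}\cdot\boldsymbol{b}=0\}$. A framed surface is a smooth map $(\boldsymbol{x},\boldsymbol{n},\boldsymbol{s}):U\to\mathbb{R}^3\times\Delta$ with $\boldsymbol{x}_u\cdot\boldsymbol{n}=\boldsymbol{x}_v\cdot\boldsymbol{n}=0$ on $U$. Put $\boldsymbol{t}=\boldsymbol{n}\times\boldsymbol{s}$. Its basic invariants are the smooth functions $a_i,b_i,e_i,f_i,g_i:U\to\mathbb{R}$ ($i=1,2$) determined by $\boldsymbol{x}_u=a_1\boldsymbol{s}+b_1\boldsymbol{t}$, $\boldsymbol{n}_u=e_1\boldsymbol{s}+f_1\boldsymbol{t}$, $\boldsymbol{s}_u=-e_1\boldsymbol{n}+g_1\boldsymbol{t}$, $\boldsymbol{t}_u=-f_1\boldsymbol{n}-g_1\boldsymbol{s}$, and the same equations with $\partial_v$ in place of $\partial_u$ and index $2$ in place of $1$. For a smooth $\lambda:U\to\mathbb{R}$, $\lambda\not\equiv0$ means that $\{(u,v)\in U:\lambda(u,v)\neq0\}$ is dense in $U$. Two framed surfaces $(\boldsymbol{x},\boldsymbol{n},\boldsymbol{s}),(\overline{\boldsymbol{x}},\overline{\boldsymbol{n}},\overline{\boldsymbol{s}}):U\to\mathbb{R}^3\times\Delta$ (with $\overline{\boldsymbol{t}}=\overline{\boldsymbol{n}}\times\overline{\boldsymbol{s}}$)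 are $(\boldsymbol{v},\overline{\boldsymbol{w}})$-mates, where each of $\boldsymbol{v},\boldsymbol{w}$ is one of $\boldsymbol{n},\boldsymbol{s},\boldsymbol{t}$, if there is a smooth $\lambda:U\to\mathbb{R}$ with $\lambda\not\equiv0$ such that $\overline{\boldsymbol{x}}=\boldsymbol{x}+\lambda\boldsymbol{v}$ and $\boldsymbol{v}=\overline{\boldsymbol{w}}$ on $U$. $(\boldsymbol{x},\boldsymbol{n},\boldsymbol{s})$ is a $(\boldsymbol{v},\overline{\boldsymbol{w}})$-Bertrand framed surface if there is a framed surface $(\overline{\boldsymbol{x}},\overline{\boldsymbol{n}},\overline{\boldsymbol{s}}):U\to\mathbb{R}^3\times\Delta$ such that the two are $(\boldsymbol{v},\overline{\boldsymbol{w}})$-mates. *)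

theory Defs
  imports "HOL-Analysis.Analysis"
begin

text \<open>
  Points \<open>(u, v)\<close> of the plane are vectors \<open>p :: real^2\<close> with \<open>u = p $ 1\<close> and \<open>v = p $ 2\<close>.
  All maps on \<open>U\<close> are total functions of which only the values on the open set \<open>U\<close> matter.
\<close>

text \<open>Class \<open>C\<^sup>k\<close> on an open set, by recursion on directional derivatives.\<close>

primrec C_k_on :: "nat \<Rightarrow> ('a::real_normed_vector \<Rightarrow> 'b::real_normed_vector) \<Rightarrow> 'a set \<Rightarrow> bool" where
  "C_k_on 0 f U \<longleftrightarrow> continuous_on U f"
| "C_k_on (Suc k) f U \<longleftrightarrow>
     (\<forall>p\<in>U. f differentiable (at p)) \<and> (\<forall>h. C_k_on k (\<lambda>p. frechet_derivative f (at p) h) U)"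

definition smooth_on :: "('a::real_normed_vector \<Rightarrow> 'b::real_normed_vector) \<Rightarrow> 'a set \<Rightarrow> bool" where
  "smooth_on f U \<longleftrightarrow> (\<forall>k. C_k_on k f U)"

text \<open>Direction \<open>1\<close> is \<open>\<partial>/\<partial>u\<close> and direction \<open>2\<close> is \<open>\<partial>/\<partial>v\<close>.\<close>

definition partial :: "2 \<Rightarrow> (real^2 \<Rightarrow> 'b::real_normed_vector) \<Rightarrow> real^2 \<Rightarrow> 'b" where
  "partial i f p = frechet_derivative f (at p) (axis i 1)"

definition simply_connected_domain :: "(real^2) set \<Rightarrow> bool" where
  "simply_connected_domain U \<longleftrightarrow> open U \<and> connected U \<and> U \<noteq> {} \<and> simply_connected U"

definition Delta :: "((real^3) \<times> (real^3)) set" where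
  "Delta = {(a, b). a \<in> sphere 0 1 \<and> b \<in> sphere 0 1 \<and> a \<bullet> b = 0}"

definition framed_surface ::
  "(real^2) set \<Rightarrow> (real^2 \<Rightarrow> real^3) \<Rightarrow> (real^2 \<Rightarrow> real^3) \<Rightarrow> (real^2 \<Rightarrow> real^3) \<Rightarrow> bool" where
  "framed_surface U x n s \<longleftrightarrow>
     smooth_on x U \<and> smooth_on n U \<and> smooth_on s U \<and>
     (\<forall>p\<in>U. (n p, s p) \<in> Delta \<and> partial 1 x p \<bullet> n p = 0 \<and> partial 2 x p \<bullet> n p = 0)"

definition third :: "(real^2 \<Rightarrow> real^3) \<Rightarrow> (real^2 \<Rightarrow> real^3) \<Rightarrow> real^2 \<Rightarrow> real^3" where
  "third n s p = cross3 (n p) (s p)"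

text \<open>
  The index \<open>i\<close> of the invariants \<open>a i, b i, e i, f i, g i\<close> ranges over the type \<open>2\<close>, whose
  two elements are \<open>1\<close> and \<open>2\<close>; the equations with index \<open>i\<close> use the derivative \<open>partial i\<close>.
\<close>

definition basic_invariants ::
  "(real^2) set \<Rightarrow> (real^2 \<Rightarrow> real^3) \<Rightarrow> (real^2 \<Rightarrow> real^3) \<Rightarrow> (real^2 \<Rightarrow> real^3) \<Rightarrow>
   (2 \<Rightarrow> real^2 \<Rightarrow> real) \<Rightarrow> (2 \<Rightarrow> real^2 \<Rightarrow> real) \<Rightarrow> (2 \<Rightarrow> real^2 \<Rightarrow> real) \<Rightarrow>
   (2 \<Rightarrow> real^2 \<Rightarrow> real) \<Rightarrow> (2 \<Rightarrow> real^2 \<Rightarrow> real) \<Rightarrow> bool" where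
  "basic_invariants U x n s a b e f g \<longleftrightarrow>
     (\<forall>i. smooth_on (a i) U \<and> smooth_on (b i) U \<and> smooth_on (e i) U \<and>
          smooth_on (f i) U \<and> smooth_on (g i) U) \<and>
     (\<forall>i. \<forall>p\<in>U.
        partial i x p = a i p *\<^sub>R s p + b i p *\<^sub>R third n s p \<and>
        partial i n p = e i p *\<^sub>R s p + f i p *\<^sub>R third n s p \<and>
        partial i s p = - e i p *\<^sub>R n p + g i p *\<^sub>R third n s p \<and>
        partial i (third n s) p = - f i p *\<^sub>R n p - g i p *\<^sub>R s p)"

definition not_identically_zero_on :: "(real^2 \<Rightarrow> real) \<Rightarrow> (real^2) set \<Rightarrow> bool" where
  "not_identically_zero_on l U \<longleftrightarrow> U \<subseteq> closure {p \<in> U. l p \<noteq> 0}"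

datatype frame_vector = Vec_n | Vec_s | Vec_t

fun frame_field ::
  "frame_vector \<Rightarrow> (real^2 \<Rightarrow> real^3) \<Rightarrow> (real^2 \<Rightarrow> real^3) \<Rightarrow> real^2 \<Rightarrow> real^3" where
  "frame_field Vec_n n s = n"
| "frame_field Vec_s n s = s"
| "frame_field Vec_t n s = third n s"

text \<open>\<open>mates U v w x n s x' n' s'\<close>: the surfaces are \<open>(v, w')\<close>-mates, \<open>w'\<close> being the \<open>w\<close> of the
  second frame.\<close>

definition mates ::
  "(real^2) set \<Rightarrow> frame_vector \<Rightarrow> frame_vector \<Rightarrow>
   (real^2 \<Rightarrow> real^3) \<Rightarrow> (real^2 \<Rightarrow> real^3) \<Rightarrow> (real^2 \<Rightarrow> real^3) \<Rightarrow>
   (real^2 \<Rightarrow> real^3) \<Rightarrow> (real^2 \<Rightarrow> real^3) \<Rightarrow> (real^2 \<Rightarrow> real^3) \<Rightarrow> bool" where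
  "mates U v w x n s x' n' s' \<longleftrightarrow>
     framed_surface U x n s \<and> framed_surface U x' n' s' \<and>
     (\<exists>l. smooth_on l U \<and> not_identically_zero_on l U \<and>
        (\<forall>p\<in>U. x' p = x p + l p *\<^sub>R frame_field v n s p \<and>
               frame_field v n s p = frame_field w n' s' p))"

definition Bertrand_framed_surface ::
  "(real^2) set \<Rightarrow> frame_vector \<Rightarrow> frame_vector \<Rightarrow>
   (real^2 \<Rightarrow> real^3) \<Rightarrow> (real^2 \<Rightarrow> real^3) \<Rightarrow> (real^2 \<Rightarrow> real^3) \<Rightarrow> bool" where
  "Bertrand_framed_surface U v w x n s \<longleftrightarrow>
     (\<exists>x' n' s'. framed_surface U x' n' s' \<and> mates U v w x n s x' n' s')"

end

theory Submission
  imports Defs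
begin

text \<open>
  Moving a framed surface along \<open>s\<close> by a function \<open>l\<close> gives \<open>y = x + l s\<close> with
  \<open>y\<^sub>i = (a\<^sub>i + l\<^sub>i) s + (b\<^sub>i + l g\<^sub>i) t - l e\<^sub>i n\<close>, where the index \<open>i\<close> of \<open>y\<close> and \<open>l\<close> denotes a
  partial derivative. The normal \<open>n'\<close> of a mate must be a smooth
  unit field orthogonal both to the shared vector \<open>s\<close> and to the \<open>y\<^sub>i\<close>. Being orthogonal to \<open>s\<close>, it
  is a rotation \<open>cos \<theta> n + sin \<theta> t\<close> of \<open>n\<close> in the plane of \<open>n\<close> and \<open>t\<close>, and orthogonality to \<open>y\<^sub>i\<close>
  then reads \<open>(b\<^sub>i + l g\<^sub>i) sin \<theta> - l e\<^sub>i cos \<theta> = 0\<close>, which is the \<open>i\<close>-th row of the matrix equation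
  (\<open>partial_parallel_inner\<close>). So the equation says exactly that \<open>n'\<close> is a normal of the parallel
  surface.

  The one point that is not algebra is that the angle \<open>\<theta>\<close> can be chosen globally and smoothly
  when \<open>n'\<close> is given. The pair \<open>(n' \<bullet> n, n' \<bullet> t)\<close> is a smooth map into the unit circle; since \<open>U\<close>
  is simply connected it lifts to a continuous angle, and a continuous angle of a smooth circle-valued
  map is automatically smooth, because locally it is an arcsine of smooth data
  (\<open>smooth_angle_exists\<close>).
\<close>

section \<open>Calculus of smooth maps\<close>

lemma C_k_on_cong:
  assumes "open U" "\<And>p. p \<in> U \<Longrightarrow> f p = f' p" "C_k_on k f U"
  shows "C_k_on k f' U"
  using assms(2,3)
proof (induction k arbitrary: f f')
  case 0
  then show ?case by (simp cong: continuous_on_cong)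
next
  case (Suc k)
  have D: "(f' has_derivative frechet_derivative f (at p)) (at p)" if "p \<in> U" for p
  proof (rule has_derivative_transform_within_open [OF _ \<open>open U\<close> that])
    show "(f has_derivative frechet_derivative f (at p)) (at p)"
      using Suc.prems(2) that by (simp add: frechet_derivative_works)
  qed (use Suc.prems(1) in auto)
  have eq: "frechet_derivative f (at p) h = frechet_derivative f' (at p) h" if "p \<in> U" for p h
    by (simp only: frechet_derivative_at [OF D [OF that]])
  have "C_k_on k (\<lambda>p. frechet_derivative f (at p) h) U" for h
    using Suc.prems(2) unfolding C_k_on.simps(2) by blast
  then have "C_k_on k (\<lambda>p. frechet_derivative f' (at p) h) U" for h
    by (rule Suc.IH [rotated]) (rule eq)
  then show ?case
    using D unfolding C_k_on.simps(2) differentiable_def by blast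
qed

text \<open>The recursion in the definition of \<open>C_k_on\<close> refers to \<open>frechet_derivative\<close>, whose value is
  only accessible through uniqueness; this introduction rule accepts any explicit derivative.\<close>

lemma C_k_on_SucI:
  assumes "open U" "\<And>p. p \<in> U \<Longrightarrow> (f has_derivative D p) (at p)"
    and "\<And>h. C_k_on k (\<lambda>p. D p h) U"
  shows "C_k_on (Suc k) f U"
proof -
  have "C_k_on k (\<lambda>p. frechet_derivative f (at p) h) U" for h
    by (rule C_k_on_cong [OF assms(1) _ assms(3)]) (simp add: frechet_derivative_at [OF assms(2), symmetric])
  then show ?thesis
    using assms(2) by (auto simp: differentiable_def)
qed

lemma C_k_on_Suc_has_derivative:
  "C_k_on (Suc k) f U \<Longrightarrow> p \<in> U \<Longrightarrow> (f has_derivative frechet_derivative f (at p)) (at p)"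
  by (simp add: frechet_derivative_works)

lemma C_k_on_Suc_imp: "C_k_on (Suc k) f U \<Longrightarrow> C_k_on k f U"
proof (induction k arbitrary: f)
  case 0
  then show ?case
    by (simp add: continuous_at_imp_continuous_on differentiable_imp_continuous_within)
next
  case (Suc k)
  have "C_k_on (Suc k) (\<lambda>p. frechet_derivative f (at p) h) U" for h
    using Suc.prems unfolding C_k_on.simps(2) [of "Suc k"] by blast
  then have "C_k_on k (\<lambda>p. frechet_derivative f (at p) h) U" for h
    by (rule Suc.IH)
  then show ?case
    using Suc.prems unfolding C_k_on.simps(2) by blast
qed

lemma C_k_on_add:
  assumes "open U" "C_k_on k f U" "C_k_on k g U"
  shows "C_k_on k (\<lambda>p. f p + g p) U"
  using assms(2,3)
proof (induction k arbitrary: f g)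
  case 0
  then show ?case by (simp add: continuous_on_add)
next
  case (Suc k)
  show ?case
    by (rule C_k_on_SucI [OF assms(1)],
        rule has_derivative_add [OF C_k_on_Suc_has_derivative C_k_on_Suc_has_derivative])
      (use Suc in auto)
qed

lemma C_k_on_bilinear:
  assumes "open U" "bounded_bilinear B" "C_k_on k f U" "C_k_on k g U"
  shows "C_k_on k (\<lambda>p. B (f p) (g p)) U"
  using assms(3,4)
proof (induction k arbitrary: f g)
  case 0
  then show ?case
    by (simp add: bounded_bilinear.continuous_on [OF assms(2)])
next
  case (Suc k)
  show ?case
  proof (rule C_k_on_SucI [OF assms(1)],
      rule bounded_bilinear.FDERIV [OF assms(2) C_k_on_Suc_has_derivative C_k_on_Suc_has_derivative])
    show "C_k_on k (\<lambda>p. B (f p) (frechet_derivative g (at p) h)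
            + B (frechet_derivative f (at p) h) (g p)) U" for h
      using Suc.prems
      by (intro C_k_on_add [OF assms(1)] Suc.IH C_k_on_Suc_imp [OF Suc.prems(1)]
          C_k_on_Suc_imp [OF Suc.prems(2)]) auto
  qed (use Suc.prems in auto)
qed

text \<open>Sine and cosine are treated as one family \<open>sin (\<theta> + r)\<close>, which is closed under
  differentiation: the derivative shifts \<open>r\<close> by \<open>\<pi>/2\<close>, without producing a sign.\<close>

lemma C_k_on_sin_shift:
  fixes \<theta> :: "'a::real_normed_vector \<Rightarrow> real"
  assumes "open U" "C_k_on k \<theta> U"
  shows "C_k_on k (\<lambda>p. sin (\<theta> p + r)) U"
  using assms(2)
proof (induction k arbitrary: r)
  case 0
  then show ?case by (auto intro!: continuous_intros)
next
  case (Suc k)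
  show ?case
  proof (rule C_k_on_SucI [OF assms(1)])
    show "((\<lambda>p. sin (\<theta> p + r)) has_derivative
        (\<lambda>h. sin (\<theta> p + (r + pi / 2)) * frechet_derivative \<theta> (at p) h)) (at p)" if "p \<in> U" for p
    proof -
      have "sin (\<theta> p + (r + pi / 2)) = cos (\<theta> p + r)"
        by (simp add: sin_add cos_add)
      then show ?thesis
        using C_k_on_Suc_has_derivative [OF Suc.prems that]
        by (auto intro!: derivative_eq_intros)
    qed
    show "C_k_on k (\<lambda>p. sin (\<theta> p + (r + pi / 2)) * frechet_derivative \<theta> (at p) h) U" for h
      using Suc.prems
      by (intro C_k_on_bilinear [OF assms(1) bounded_bilinear_mult] Suc.IH
          C_k_on_Suc_imp [OF Suc.prems]) auto
  qed
qed

lemma smooth_on_has_derivative: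
  "smooth_on f U \<Longrightarrow> p \<in> U \<Longrightarrow> (f has_derivative frechet_derivative f (at p)) (at p)"
  unfolding smooth_on_def by (blast intro: C_k_on_Suc_has_derivative)

lemma smooth_on_frechet_derivative:
  "smooth_on f U \<Longrightarrow> C_k_on k (\<lambda>p. frechet_derivative f (at p) h) U"
  unfolding smooth_on_def by (metis C_k_on.simps(2))

lemma smooth_on_imp_continuous_on: "smooth_on f U \<Longrightarrow> continuous_on U f"
  unfolding smooth_on_def by (metis C_k_on.simps(1))

lemma smooth_on_add:
  "open U \<Longrightarrow> smooth_on f U \<Longrightarrow> smooth_on g U \<Longrightarrow> smooth_on (\<lambda>p. f p + g p) U"
  by (simp add: smooth_on_def C_k_on_add)

lemma smooth_on_bilinear:
  "open U \<Longrightarrow> bounded_bilinear B \<Longrightarrow> smooth_on f U \<Longrightarrow> smooth_on g U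
    \<Longrightarrow> smooth_on (\<lambda>p. B (f p) (g p)) U"
  by (simp add: smooth_on_def C_k_on_bilinear)

lemma smooth_on_sin_cos:
  fixes \<theta> :: "'a::real_normed_vector \<Rightarrow> real"
  assumes "open U" "smooth_on \<theta> U"
  shows "smooth_on (\<lambda>p. sin (\<theta> p)) U" "smooth_on (\<lambda>p. cos (\<theta> p)) U"
proof -
  have "smooth_on (\<lambda>p. sin (\<theta> p + r)) U" for r
    using assms by (simp add: smooth_on_def C_k_on_sin_shift)
  from this [of 0] this [of "pi / 2"]
  show "smooth_on (\<lambda>p. sin (\<theta> p)) U" "smooth_on (\<lambda>p. cos (\<theta> p)) U"
    by (simp_all add: sin_add)
qed

lemma smooth_on_third:
  "open U \<Longrightarrow> smooth_on n U \<Longrightarrow> smooth_on s U \<Longrightarrow> smooth_on (third n s) U"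
  unfolding third_def [abs_def]
  by (rule smooth_on_bilinear) (simp_all add: bilinear_cross flip: bilinear_conv_bounded_bilinear)

section \<open>Smooth angle functions\<close>

text \<open>Near a point \<open>p\<close> the difference \<open>\<theta> q - \<theta> p\<close> stays within \<open>(-\<pi>/2, \<pi>/2)\<close>, so it is the arcsine of
  \<open>sin (\<theta> q - \<theta> p)\<close>, which is a linear combination of the sine and the cosine of \<open>\<theta> q\<close>.\<close>

lemma continuous_angle_has_derivative:
  fixes \<theta> c d :: "'a::real_normed_vector \<Rightarrow> real"
  assumes "open U" "continuous_on U \<theta>" "p \<in> U"
    and cos: "\<And>q. q \<in> U \<Longrightarrow> cos (\<theta> q) = c q" and sin: "\<And>q. q \<in> U \<Longrightarrow> sin (\<theta> q) = d q"
    and c: "(c has_derivative c') (at p)" and d: "(d has_derivative d') (at p)"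
  shows "(\<theta> has_derivative (\<lambda>h. c p * d' h - d p * c' h)) (at p)"
proof -
  define V where "V = {q \<in> U. dist (\<theta> q) (\<theta> p) < pi / 2}"
  have "open V"
  proof -
    have "V = U \<inter> \<theta> -` ball (\<theta> p) (pi / 2)"
      by (auto simp: V_def dist_commute)
    then show ?thesis
      using continuous_open_preimage [OF assms(2,1)] by auto
  qed
  have "p \<in> V"
    using assms(3) by (simp add: V_def)
  \<comment> \<open>The arcsine is differentiated at \<open>0\<close>, where its derivative is \<open>1\<close>.\<close>
  have zero: "d p * c p - c p * d p = 0"
    by simp
  have "((\<lambda>q. \<theta> p + arcsin (d q * c p - c q * d p)) has_derivative
      (\<lambda>h. c p * d' h - d p * c' h)) (at p)"
    by (rule derivative_eq_intros c d refl | simp add: zero algebra_simps)+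
  moreover have "\<theta> p + arcsin (d q * c p - c q * d p) = \<theta> q" if "q \<in> V" for q
  proof -
    have "\<bar>\<theta> q - \<theta> p\<bar> < pi / 2" "q \<in> U"
      using that by (auto simp: V_def dist_real_def)
    moreover have "d q * c p - c q * d p = sin (\<theta> q - \<theta> p)"
      using \<open>q \<in> U\<close> assms(3) by (simp add: sin_diff cos sin)
    moreover from calculation(1) have "arcsin (sin (\<theta> q - \<theta> p)) = \<theta> q - \<theta> p"
      by (intro arcsin_sin) linarith+
    ultimately show ?thesis
      by simp
  qed
  ultimately show ?thesis
    using has_derivative_transform_within_open [OF _ \<open>open V\<close> \<open>p \<in> V\<close>] by blast
qed

lemma continuous_angle_smooth:
  fixes \<theta> c d :: "'a::real_normed_vector \<Rightarrow> real"
  assumes "open U" "continuous_on U \<theta>" and c: "smooth_on c U" and d: "smooth_on d U"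
    and cos: "\<And>q. q \<in> U \<Longrightarrow> cos (\<theta> q) = c q" and sin: "\<And>q. q \<in> U \<Longrightarrow> sin (\<theta> q) = d q"
  shows "smooth_on \<theta> U"
  unfolding smooth_on_def
proof
  fix k
  show "C_k_on k \<theta> U"
  proof (cases k)
    case 0
    then show ?thesis using assms(2) by simp
  next
    case (Suc m)
    have "C_k_on (Suc m) \<theta> U"
    proof (rule C_k_on_SucI [OF assms(1)])
      \<comment> \<open>The sign in \<open>c d' - d c'\<close> is moved into the direction \<open>h\<close>, so that sums and products suffice.\<close>
      show "(\<theta> has_derivative (\<lambda>h. c p * frechet_derivative d (at p) h
          + d p * frechet_derivative c (at p) (- h))) (at p)" if "p \<in> U" for p
        using continuous_angle_has_derivative [OF assms(1,2) that cos sin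
            smooth_on_has_derivative [OF c that] smooth_on_has_derivative [OF d that]]
          linear_neg [OF has_derivative_linear [OF smooth_on_has_derivative [OF c that]]]
        by simp
      show "C_k_on m (\<lambda>p. c p * frechet_derivative d (at p) h
          + d p * frechet_derivative c (at p) (- h)) U" for h
        using c d smooth_on_frechet_derivative [OF c] smooth_on_frechet_derivative [OF d]
        by (intro C_k_on_add C_k_on_bilinear [OF _ bounded_bilinear_mult] assms(1))
          (auto simp: smooth_on_def)
    qed
    then show ?thesis using Suc by simp
  qed
qed

text \<open>The continuous angle is the imaginary part of a logarithm of \<open>c + \<i> d\<close>, which exists because
  \<open>U\<close> is simply connected.\<close>

lemma smooth_angle_exists:
  fixes c d :: "'a::real_normed_vector \<Rightarrow> real"
  assumes "open U" "simply_connected U" and c: "smooth_on c U" and d: "smooth_on d U"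
    and unit: "\<And>q. q \<in> U \<Longrightarrow> (c q)\<^sup>2 + (d q)\<^sup>2 = 1"
  obtains \<theta> where "smooth_on \<theta> U" "\<And>q. q \<in> U \<Longrightarrow> cos (\<theta> q) = c q" "\<And>q. q \<in> U \<Longrightarrow> sin (\<theta> q) = d q"
proof -
  define F where "F q = Complex (c q) (d q)" for q
  have norm: "norm (F q) = 1" if "q \<in> U" for q
    using unit [OF that] by (simp add: F_def cmod_def)
  have "continuous_on U F"
    unfolding F_def Complex_eq using c d by (intro continuous_intros smooth_on_imp_continuous_on)
  moreover have "F q \<noteq> 0" if "q \<in> U" for q
    using norm [OF that] by auto
  ultimately obtain L where L: "continuous_on U L" "\<And>q. q \<in> U \<Longrightarrow> F q = exp (L q)"
    using continuous_logarithm_on_simply_connected [OF _ assms(2) open_imp_locally_path_connected [OF assms(1)]]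
    by metis
  have "Re (L q) = 0" if "q \<in> U" for q
    using norm [OF that] L(2) [OF that] by simp
  then have *: "cos (Im (L q)) = c q" "sin (Im (L q)) = d q" if "q \<in> U" for q
    using that L(2) [OF that] by (auto simp: F_def complex_eq_iff Re_exp Im_exp)
  have "continuous_on U (\<lambda>q. Im (L q))"
    using L(1) by (intro continuous_intros)
  then show thesis
    using that continuous_angle_smooth [OF assms(1) _ c d] * by blast
qed

section \<open>Surfaces parallel along s\<close>

text \<open>Pairing with a vector \<open>w\<close> orthogonal to \<open>s\<close> removes the \<open>s\<close>-component of the partial derivative,
  and with it the invariants \<open>a\<close> and the derivatives of \<open>l\<close>; both directions of the theorem use this
  with \<open>w\<close> the new normal.\<close>

lemma partial_parallel_inner:
  assumes "framed_surface U x n s" "basic_invariants U x n s a b e f g" "smooth_on l U"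
    and "p \<in> U" "s p \<bullet> w = 0"
  shows "partial i (\<lambda>p. x p + l p *\<^sub>R s p) p \<bullet> w
    = (b i p + l p * g i p) * (third n s p \<bullet> w) - l p * e i p * (n p \<bullet> w)"
proof -
  have smooth: "smooth_on x U" "smooth_on s U"
    using assms(1) by (auto simp: framed_surface_def)
  have "((\<lambda>p. x p + l p *\<^sub>R s p) has_derivative (\<lambda>h. frechet_derivative x (at p) h
      + (l p *\<^sub>R frechet_derivative s (at p) h + frechet_derivative l (at p) h *\<^sub>R s p))) (at p)"
    by (intro has_derivative_add has_derivative_scaleR smooth_on_has_derivative [OF _ assms(4)] smooth assms)
  then have "partial i (\<lambda>p. x p + l p *\<^sub>R s p) p
      = partial i x p + (l p *\<^sub>R partial i s p + partial i l p *\<^sub>R s p)"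
    unfolding partial_def by (simp flip: frechet_derivative_at)
  moreover have "partial i x p = a i p *\<^sub>R s p + b i p *\<^sub>R third n s p"
    "partial i s p = - e i p *\<^sub>R n p + g i p *\<^sub>R third n s p"
    using assms(2,4) by (auto simp: basic_invariants_def)
  ultimately have "partial i (\<lambda>p. x p + l p *\<^sub>R s p) p \<bullet> w
      = (a i p *\<^sub>R s p + b i p *\<^sub>R third n s p
        + (l p *\<^sub>R (- e i p *\<^sub>R n p + g i p *\<^sub>R third n s p) + partial i l p *\<^sub>R s p)) \<bullet> w"
    by simp
  then show ?thesis
    by (simp only: inner_add_left inner_scaleR_left assms(5)) (simp add: algebra_simps)
qed

lemma partial_cong:
  assumes "open U" "p \<in> U" "\<And>q. q \<in> U \<Longrightarrow> f q = f' q" "smooth_on f U"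
  shows "partial i f p = partial i f' p"
proof -
  have "(f' has_derivative frechet_derivative f (at p)) (at p)"
    using has_derivative_transform_within_open [OF smooth_on_has_derivative [OF assms(4,2)] assms(1,2)]
      assms(3) by blast
  then show ?thesis
    unfolding partial_def by (simp flip: frechet_derivative_at)
qed

text \<open>The coordinates of a vector of \<open>s\<^sup>\<bottom>\<close> in the orthonormal basis \<open>n\<close>, \<open>t\<close>: rotate it by a right
  angle about \<open>s\<close>, using \<open>s = t \<times> n\<close>, and rotate back.\<close>

lemma orthogonal_unit_coordinates:
  fixes w n s :: "real^3"
  assumes "(n, s) \<in> Delta" "w \<bullet> s = 0" "norm w = 1"
  shows "(w \<bullet> n)\<^sup>2 + (w \<bullet> cross3 n s)\<^sup>2 = 1"
proof -
  have ns: "n \<bullet> n = 1" "s \<bullet> s = 1" "n \<bullet> s = 0" "s \<bullet> n = 0" "s \<bullet> w = 0" "w \<bullet> w = 1"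
    using assms by (auto simp: Delta_def dot_square_norm inner_commute)
  define t where "t = cross3 n s"
  have tn: "cross3 t n = s"
    using ns Lagrange [of n n s] by (simp add: t_def cross_skew [of "cross3 n s"])
  have st: "cross3 s t = n"
    using ns Lagrange [of s n s] by (simp add: t_def)
  have "cross3 w s = (w \<bullet> n) *\<^sub>R t - (w \<bullet> t) *\<^sub>R n"
    using Lagrange [of w t n] by (simp add: tn)
  then have "cross3 s (cross3 w s) = (w \<bullet> n) *\<^sub>R n + (w \<bullet> t) *\<^sub>R t"
    using cross_skew [of s n]
    by (simp add: Cross3.right_diff_distrib cross_mult_right st flip: t_def)
  moreover have "cross3 s (cross3 w s) = w"
    using ns Lagrange [of s w s] by simp
  ultimately have "w \<bullet> w = w \<bullet> ((w \<bullet> n) *\<^sub>R n + (w \<bullet> t) *\<^sub>R t)"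
    by simp
  then show ?thesis
    using ns by (simp add: inner_add_right power2_eq_square t_def)
qed

lemma frame_inner:
  assumes "(n p, s p) \<in> Delta"
  shows "n p \<bullet> n p = 1" "s p \<bullet> s p = 1" "n p \<bullet> s p = 0" "s p \<bullet> n p = 0"
    "third n s p \<bullet> third n s p = 1" "third n s p \<bullet> n p = 0" "n p \<bullet> third n s p = 0"
    "third n s p \<bullet> s p = 0" "s p \<bullet> third n s p = 0"
  using assms
  by (auto simp: Delta_def third_def dot_square_norm norm_cross dot_cross_self inner_commute)

lemma matrix_row_equations:
  fixes A B C D u v :: real
  shows "(vector [vector [A, B], vector [C, D]] :: real^2^2) *v vector [u, - v] = vector [0, 0]
    \<longleftrightarrow> A * u - B * v = 0 \<and> C * u - D * v = 0"
  by (simp add: vec_eq_iff forall_2 matrix_vector_mult_def sum_2)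

theorem theorem3p15:
  fixes U :: "(real^2) set"
    and x n s :: "real^2 \<Rightarrow> real^3"
    and a b e f g :: "2 \<Rightarrow> real^2 \<Rightarrow> real"
  assumes "simply_connected_domain U"
    and "framed_surface U x n s"
    and "basic_invariants U x n s a b e f g"
  shows "Bertrand_framed_surface U Vec_s Vec_s x n s \<longleftrightarrow>
    (\<exists>l \<theta> :: real^2 \<Rightarrow> real. smooth_on l U \<and> smooth_on \<theta> U \<and> not_identically_zero_on l U \<and>
      (\<forall>p\<in>U.
        (vector [vector [b 1 p + l p * g 1 p, l p * e 1 p],
                 vector [b 2 p + l p * g 2 p, l p * e 2 p]] :: real^2^2)
          *v vector [sin (\<theta> p), - cos (\<theta> p)] = (vector [0, 0] :: real^2)))"
    (is "_ \<longleftrightarrow> (\<exists>l \<theta>. ?P l \<theta>)")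
proof -
  have U: "open U" "simply_connected U"
    using assms(1) by (auto simp: simply_connected_domain_def)
  have x: "smooth_on x U" and n: "smooth_on n U" and s: "smooth_on s U"
    and \<Delta>: "\<And>p. p \<in> U \<Longrightarrow> (n p, s p) \<in> Delta"
    using assms(2) by (auto simp: framed_surface_def)
  note t = smooth_on_third [OF U(1) n s]
  note row = partial_parallel_inner [OF assms(2,3)]
  show ?thesis
  proof
    assume "Bertrand_framed_surface U Vec_s Vec_s x n s"
    then obtain x' n' s' l where fs': "framed_surface U x' n' s'"
      and l: "smooth_on l U" "not_identically_zero_on l U"
      and x': "\<And>p. p \<in> U \<Longrightarrow> x' p = x p + l p *\<^sub>R s p" and s': "\<And>p. p \<in> U \<Longrightarrow> s' p = s p"
      by (auto simp: Bertrand_framed_surface_def mates_def)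
    have n': "smooth_on n' U" and x'_smooth: "smooth_on x' U"
      using fs' by (auto simp: framed_surface_def)
    have \<Delta>': "(n' p, s p) \<in> Delta" if "p \<in> U" for p
      using fs' s' that by (auto simp: framed_surface_def)
    have tangent': "partial 1 x' p \<bullet> n' p = 0" "partial 2 x' p \<bullet> n' p = 0" if "p \<in> U" for p
      using fs' that by (auto simp: framed_surface_def)
    have cd: "smooth_on (\<lambda>p. n' p \<bullet> n p) U" "smooth_on (\<lambda>p. n' p \<bullet> third n s p) U"
      by (intro smooth_on_bilinear [OF U(1) bounded_bilinear_inner] n n' t)+
    have circle: "(n' p \<bullet> n p)\<^sup>2 + (n' p \<bullet> third n s p)\<^sup>2 = 1" if "p \<in> U" for p
      unfolding third_def using \<Delta>' [OF that]
      by (intro orthogonal_unit_coordinates \<Delta> that) (auto simp: Delta_def)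
    obtain \<theta> where \<theta>: "smooth_on \<theta> U"
      "\<And>p. p \<in> U \<Longrightarrow> cos (\<theta> p) = n' p \<bullet> n p" "\<And>p. p \<in> U \<Longrightarrow> sin (\<theta> p) = n' p \<bullet> third n s p"
      using smooth_angle_exists [OF U cd circle] by blast
    have "(b i p + l p * g i p) * sin (\<theta> p) - l p * e i p * cos (\<theta> p) = partial i x' p \<bullet> n' p"
      if "p \<in> U" for i p
      using row [OF l(1) that frame_inner(4) [of n' p s, OF \<Delta>' [OF that]], of i]
        partial_cong [OF U(1) that x' x'_smooth, of i] \<theta>(2,3) [OF that]
      by (simp add: inner_commute)
    then have "?P l \<theta>"
      using l \<theta>(1) tangent' by (simp add: matrix_row_equations)
    then show "\<exists>l \<theta>. ?P l \<theta>"
      by blast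
  next
    assume "\<exists>l \<theta>. ?P l \<theta>"
    then obtain l \<theta> where P: "?P l \<theta>"
      by blast
    then have l: "smooth_on l U" "not_identically_zero_on l U" and \<theta>: "smooth_on \<theta> U"
      by auto
    define y where "y = (\<lambda>p. x p + l p *\<^sub>R s p)"
    define m where "m = (\<lambda>p. sin (\<theta> p) *\<^sub>R third n s p + cos (\<theta> p) *\<^sub>R n p)"
    have "smooth_on y U"
      unfolding y_def
      by (intro smooth_on_add smooth_on_bilinear [OF _ bounded_bilinear_scaleR] U x l s)
    moreover have "smooth_on m U"
      unfolding m_def
      by (intro smooth_on_add smooth_on_bilinear [OF _ bounded_bilinear_scaleR] smooth_on_sin_cos
          U t n \<theta>)
    moreover have "(m p, s p) \<in> Delta" if "p \<in> U" for p
    proof -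
      note frame = frame_inner [of n p s, OF \<Delta> [OF that]]
      have "m p \<bullet> m p = 1"
        using sin_cos_squared_add [of "\<theta> p"]
        by (simp add: m_def inner_simps frame power2_eq_square)
      then show ?thesis
        by (auto simp: Delta_def norm_eq_1 frame m_def inner_simps)
    qed
    moreover have "partial 1 y p \<bullet> m p = 0 \<and> partial 2 y p \<bullet> m p = 0" if "p \<in> U" for p
    proof -
      note frame = frame_inner [of n p s, OF \<Delta> [OF that]]
      have orth: "s p \<bullet> m p = 0" and coord: "third n s p \<bullet> m p = sin (\<theta> p)" "n p \<bullet> m p = cos (\<theta> p)"
        by (simp_all add: m_def inner_simps frame)
      show ?thesis
        using P that row [OF l(1) that orth] unfolding y_def
        by (simp add: matrix_row_equations coord)
    qed
    ultimately have "framed_surface U y m s"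
      using s by (simp add: framed_surface_def)
    then have "mates U Vec_s Vec_s x n s y m s"
      using assms(2) l by (auto simp: mates_def y_def)
    then show "Bertrand_framed_surface U Vec_s Vec_s x n s"
      using \<open>framed_surface U y m s\<close> by (auto simp: Bertrand_framed_surface_def)
  qed
qed

end
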